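(* Fix an integer $k\ge 1$. There is a constant $c_k>0$ such that for every $n$, every $A\in L_n^k$ contains a monotone subsequence of length at least $c_k\sqrt{n}$. Moreover, this is tight up to the multiplicative constant: there is a constant $C_k$ such that for every $n$ there exists $A\in L_n^k$ in which every monotone subsequence has length at most $C_k\sqrt{n}$.
   Context: An order-$n$ $k$-dimensional permutation is an array $A:[n]^{k+1}\to\{0,1\}$ such that every line contains exactly one $1$, where a line is the set of positions obtained by fixing $k$ of the $k+1$ coordinates and letting the remaining coordinate range over $[n]$. $L_n^k$ denotes the set of all such arrays. The support of $A$ is $G_A=\{\alpha\in[n]^{k+1}:A(\alpha)=1\}$. A monotone subsequence of length $m$ in $A$ is a sequence $\alpha^1,\dots,\alpha^m\in G_A$ such that for every coordinate $1\le j\le k+1$ the sequence $\alpha^1_j,\alpha^2_j,\dots,\alpha^m_j$ is strictly monotone (strictly increasing or strictly decreasing; the direction may depend on $j$). *)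

theory Defs
  imports Complex_Main "HOL-Library.FuncSet"
begin

(* Coordinates are indexed by {1..k+1}; a position is an extensional function on the coordinates,
   and likewise an array is an extensional function on the positions. *)

definition positions :: "nat \<Rightarrow> nat \<Rightarrow> (nat \<Rightarrow> nat) set" where
  "positions n k = {1..k + 1} \<rightarrow>\<^sub>E {1..n}"

definition lines :: "nat \<Rightarrow> nat \<Rightarrow> (nat \<Rightarrow> nat) set set" where
  "lines n k = {{\<alpha> \<in> positions n k. \<forall>i \<in> {1..k + 1} - {j}. \<alpha> i = v i} | j v.
      j \<in> {1..k + 1} \<and> v \<in> ({1..k + 1} - {j}) \<rightarrow>\<^sub>E {1..n}}"

definition permutation_arrays :: "nat \<Rightarrow> nat \<Rightarrow> ((nat \<Rightarrow> nat) \<Rightarrow> nat) set" where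
  "permutation_arrays n k =
     {A \<in> positions n k \<rightarrow>\<^sub>E {0, 1}. \<forall>l \<in> lines n k. \<exists>!\<alpha>. \<alpha> \<in> l \<and> A \<alpha> = 1}"

definition array_support ::
    "nat \<Rightarrow> nat \<Rightarrow> ((nat \<Rightarrow> nat) \<Rightarrow> nat) \<Rightarrow> (nat \<Rightarrow> nat) set" where
  "array_support n k A = {\<alpha> \<in> positions n k. A \<alpha> = 1}"

(* The length of the subsequence is the length of the list; the empty list is admitted. *)
definition monotone_subsequence ::
    "nat \<Rightarrow> nat \<Rightarrow> ((nat \<Rightarrow> nat) \<Rightarrow> nat) \<Rightarrow> (nat \<Rightarrow> nat) list \<Rightarrow> bool" where
  "monotone_subsequence n k A \<alpha>s \<longleftrightarrow>
     set \<alpha>s \<subseteq> array_support n k A \<and>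
     (\<forall>j \<in> {1..k + 1}. sorted_wrt (<) (map (\<lambda>\<alpha>. \<alpha> j) \<alpha>s) \<or>
                     sorted_wrt (>) (map (\<lambda>\<alpha>. \<alpha> j) \<alpha>s))"

end

theory Submission
  imports Defs "HOL-Library.Discrete_Functions"
begin

text \<open>Lower bound: if all monotone subsequences have length at most \<open>l\<close>, label each point of the
  support by the lengths of the longest chains below it, in the two orders in which the first \<open>k\<close>
  coordinates increase and the last one increases or decreases. Within one of the at most \<open>l\<^sup>2\<close>
  label classes, points that are comparable in the first \<open>k\<close> coordinates agree in the last one, and
  such a class has at most \<open>(k + 1) n ^ (k - 1)\<close> points: the minimal ones form an antichain, and
  the others are determined by their coordinates \<open>2, \<dots>, k\<close>. As the support has \<open>n ^ k\<close> points,
  \<open>n \<le> (k + 1) l\<^sup>2\<close>.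

  Upper bound: take the points with \<open>\<sigma>(x\<^sub>1) + x\<^sub>2 + \<dots> + x\<^sub>k\<^sub>+\<^sub>1 = 0\<close> modulo \<open>n\<close>, where \<open>\<sigma>\<close> moves the
  elements of each block of about \<open>n\<^sup>1\<^sup>/\<^sup>2\<close> consecutive numbers far apart. A monotone sequence meets
  only \<open>O(n\<^sup>1\<^sup>/\<^sup>2)\<close> products of blocks, and each of them in a bounded number of points.\<close>

section \<open>Positions, lines and the size of the support\<close>

lemma positionsI:
  assumes "\<And>i. i \<in> {1..k + 1} \<Longrightarrow> 1 \<le> \<alpha> i \<and> \<alpha> i \<le> n" "\<And>i. i \<notin> {1..k + 1} \<Longrightarrow> \<alpha> i = undefined"
  shows "\<alpha> \<in> positions n k"
  unfolding positions_def using assms by (intro PiE_I) auto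

lemma positionsD:
  assumes "\<alpha> \<in> positions n k" "i \<in> {1..k + 1}"
  shows "1 \<le> \<alpha> i" "\<alpha> i \<le> n"
  using PiE_mem[OF assms(1)[unfolded positions_def] assms(2)] by auto

lemma position_in_line_through:
  assumes "\<alpha> \<in> positions n k" "j \<in> {1..k + 1}"
  defines "l \<equiv> {\<beta> \<in> positions n k. \<forall>i \<in> {1..k + 1} - {j}. \<beta> i = \<alpha> i}"
  shows "l \<in> lines n k"
proof -
  define v where "v = restrict \<alpha> ({1..k + 1} - {j})"
  have "v \<in> ({1..k + 1} - {j}) \<rightarrow>\<^sub>E {1..n}"
    unfolding v_def using positionsD[OF assms(1)] by auto
  moreover have "l = {\<beta> \<in> positions n k. \<forall>i \<in> {1..k + 1} - {j}. \<beta> i = v i}"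
    unfolding l_def v_def by auto
  ultimately show ?thesis unfolding lines_def using assms(2) by blast
qed

text \<open>Both points lie on the line through \<open>\<alpha>\<close> in direction
  \<open>j\<close>, which holds a single 1.\<close>

lemma array_support_eqI:
  assumes "A \<in> permutation_arrays n k" "\<alpha> \<in> array_support n k A" "\<beta> \<in> array_support n k A"
    and "j \<in> {1..k + 1}" "\<And>i. i \<in> {1..k + 1} - {j} \<Longrightarrow> \<beta> i = \<alpha> i"
  shows "\<alpha> = \<beta>"
proof -
  let ?l = "{\<gamma> \<in> positions n k. \<forall>i \<in> {1..k + 1} - {j}. \<gamma> i = \<alpha> i}"
  have pos: "\<alpha> \<in> positions n k" "\<beta> \<in> positions n k" and one: "A \<alpha> = 1" "A \<beta> = 1"
    using assms(2,3) by (auto simp: array_support_def)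
  have "\<exists>!\<gamma>. \<gamma> \<in> ?l \<and> A \<gamma> = 1"
    using assms(1) position_in_line_through[OF pos(1) assms(4)]
    by (auto simp: permutation_arrays_def)
  moreover have "\<alpha> \<in> ?l" "\<beta> \<in> ?l" using pos assms(5) by auto
  ultimately show ?thesis using one by blast
qed

lemma finite_positions: "finite (positions n k)"
  unfolding positions_def by (intro finite_PiE) auto

lemma finite_array_support: "finite (array_support n k A)"
  unfolding array_support_def using finite_positions by simp

text \<open>Every line in direction \<open>k + 1\<close> contains a support point, so forgetting the
  last coordinate maps the support onto all choices of the first \<open>k\<close>
  coordinates.\<close>

lemma card_array_support_ge:
  assumes "A \<in> permutation_arrays n k"
  shows "n ^ k \<le> card (array_support n k A)"
proof -
  let ?V = "({1..k + 1} - {k + 1}) \<rightarrow>\<^sub>E {1..n}"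
  have "?V \<subseteq> (\<lambda>\<alpha>. restrict \<alpha> ({1..k + 1} - {k + 1})) ` array_support n k A"
  proof
    fix v assume v: "v \<in> ?V"
    let ?l = "{\<gamma> \<in> positions n k. \<forall>i \<in> {1..k + 1} - {k + 1}. \<gamma> i = v i}"
    have "?l \<in> lines n k"
      unfolding lines_def using v by (intro CollectI exI[of _ "k + 1"] exI[of _ v]) simp
    then obtain \<alpha> where \<alpha>: "\<alpha> \<in> ?l" "A \<alpha> = 1"
      using assms by (auto simp: permutation_arrays_def)
    have "v = restrict \<alpha> ({1..k + 1} - {k + 1})"
    proof
      fix i show "v i = restrict \<alpha> ({1..k + 1} - {k + 1}) i"
        using \<alpha>(1) PiE_arb[OF v, of i] by (cases "i \<in> {1..k + 1} - {k + 1}") simp_all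
    qed
    moreover have "\<alpha> \<in> array_support n k A" using \<alpha> by (auto simp: array_support_def)
    ultimately show "v \<in> (\<lambda>\<alpha>. restrict \<alpha> ({1..k + 1} - {k + 1})) ` array_support n k A" by blast
  qed
  then have "card ?V \<le> card (array_support n k A)"
    using finite_array_support surj_card_le by blast
  moreover have "card ?V = n ^ k" by (subst card_PiE) auto
  ultimately show ?thesis by simp
qed

section \<open>Lower bound: chain heights, antichains and label classes\<close>

lemma chain_height:
  fixes G :: "'a set"
  assumes "transp R"
    and bound: "\<And>xs. set xs \<subseteq> G \<Longrightarrow> sorted_wrt R xs \<Longrightarrow> length xs \<le> l"
  obtains f :: "'a \<Rightarrow> nat" where "\<And>x. x \<in> G \<Longrightarrow> f x < l"
    and "\<And>x y. x \<in> G \<Longrightarrow> y \<in> G \<Longrightarrow> R x y \<Longrightarrow> f x < f y"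
proof -
  \<comment> \<open>\<open>C x\<close> consists of the chains lying entirely below \<open>x\<close>.
    Since \<open>x\<close> itself is left out, appending it gives a chain of length
    \<open>f x + 1\<close>, whence the strict bound \<open>f x < l\<close>; and if
    \<open>R x y\<close>, this longer chain lies below \<open>y\<close>.\<close>
  define C where "C x = {xs. set xs \<subseteq> G \<and> sorted_wrt R xs \<and> (\<forall>z \<in> set xs. R z x)}" for x
  define f where "f x = Max (length ` C x)" for x
  have ext: "xs @ [x] \<in> {xs. set xs \<subseteq> G \<and> sorted_wrt R xs}" if "x \<in> G" "xs \<in> C x" for x xs
    using that by (auto simp: C_def sorted_wrt_append)
  have "length ` C x \<subseteq> {..l}" for x
    using bound by (auto simp: C_def)
  then have fin: "finite (length ` C x)" for x
    using finite_subset by blast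
  have ne: "length ` C x \<noteq> {}" for x
  proof -
    have "[] \<in> C x" by (auto simp: C_def)
    then show ?thesis by blast
  qed
  have ex: "\<exists>xs \<in> C x. f x = length xs" for x
    using Max_in[OF fin ne, of x] unfolding f_def by auto
  show ?thesis
  proof
    fix x assume x: "x \<in> G"
    obtain xs where xs: "xs \<in> C x" "f x = length xs" using ex by blast
    show "f x < l" using bound[of "xs @ [x]"] ext[OF x xs(1)] xs(2) by auto
  next
    fix x y assume x: "x \<in> G" and y: "y \<in> G" and xy: "R x y"
    obtain xs where xs: "xs \<in> C x" "f x = length xs" using ex by blast
    have "R z y" if "z \<in> set (xs @ [x])" for z
      using that xs(1) xy \<open>transp R\<close> by (auto simp: C_def dest: transpD)
    then have "xs @ [x] \<in> C y" using ext[OF x xs(1)] by (auto simp: C_def)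
    then have "length (xs @ [x]) \<le> f y" unfolding f_def using fin by (intro Max_ge imageI)
    then show "f x < f y" using xs(2) by simp
  qed
qed

text \<open>An element of an antichain is determined by the diagonal containing it, and a diagonal is
  named by the differences to a smallest coordinate.\<close>

lemma card_strict_antichain_le:
  assumes "k \<ge> 1" "S \<subseteq> {1..k} \<rightarrow>\<^sub>E {1..n}"
    and anti: "\<And>x y. x \<in> S \<Longrightarrow> y \<in> S \<Longrightarrow> \<not> (\<forall>j \<in> {1..k}. x j < y j)"
  shows "card S \<le> k * n ^ (k - 1)"
proof -
  define P where "P j = {x \<in> S. \<forall>i \<in> {1..k}. x j \<le> x i}" for j :: nat
  have "S \<subseteq> (\<Union>j \<in> {1..k}. P j)"
  proof
    fix x assume x: "x \<in> S"
    have "1 \<in> {1..k}" using assms(1) by simp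
    then obtain j where "j \<in> {1..k}" "\<And>i. i \<in> {1..k} \<Longrightarrow> x j \<le> x i"
      using ex_has_least_nat[of "\<lambda>j. j \<in> {1..k}" 1 x] by blast
    then show "x \<in> (\<Union>j \<in> {1..k}. P j)" using x by (force simp: P_def)
  qed
  moreover have fin: "finite S" using assms(2) by (rule finite_subset) (intro finite_PiE, auto)
  then have "finite (\<Union>j \<in> {1..k}. P j)" by (auto simp: P_def)
  ultimately have "card S \<le> card (\<Union>j \<in> {1..k}. P j)" by (metis card_mono)
  also have "\<dots> \<le> (\<Sum>j \<in> {1..k}. card (P j))" by (rule card_UN_le) simp
  also have "\<dots> \<le> (\<Sum>j \<in> {1..k}. n ^ (k - 1))"
  proof (rule sum_mono)
    fix j assume j: "j \<in> {1..k}"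
    define d where "d x = restrict (\<lambda>i. x i - x j) ({1..k} - {j})" for x :: "nat \<Rightarrow> nat"
    have "inj_on d (P j)"
    proof (rule inj_onI)
      fix x y assume x: "x \<in> P j" and y: "y \<in> P j" and eq: "d x = d y"
      have diff: "x i - x j = y i - y j" if "i \<in> {1..k}" for i
        using fun_cong[OF eq, of i] that by (cases "i = j") (auto simp: d_def)
      have le: "x j \<le> x i" "y j \<le> y i" if "i \<in> {1..k}" for i
        using x y that by (auto simp: P_def)
      have S: "x \<in> S" "y \<in> S" using x y by (auto simp: P_def)
      \<comment> \<open>The differences agree, so a strict inequality at \<open>j\<close> would
        carry over to every coordinate, against \<open>anti\<close>.\<close>
      have "\<not> x j < y j" "\<not> y j < x j"
        using anti[OF S] anti[OF S(2) S(1)] diff le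
        by (metis le_add_diff_inverse add_less_cancel_right)+
      then have "x i = y i" if "i \<in> {1..k}" for i
        using diff[OF that] le[OF that] by auto
      then show "x = y"
        by (rule PiE_ext[OF subsetD[OF assms(2) S(1)] subsetD[OF assms(2) S(2)]])
    qed
    moreover have "d ` P j \<subseteq> ({1..k} - {j}) \<rightarrow>\<^sub>E {0..<n}"
    proof
      fix z assume "z \<in> d ` P j"
      then obtain x where x: "x \<in> S" and z: "z = d x" by (auto simp: P_def)
      have "x i \<in> {1..n}" if "i \<in> {1..k}" for i
        using PiE_mem[OF subsetD[OF assms(2) x] that] .
      have "x i - x j < n" if "i \<in> {1..k}" for i
        using \<open>\<And>i. i \<in> {1..k} \<Longrightarrow> x i \<in> {1..n}\<close>[OF that]
          \<open>\<And>i. i \<in> {1..k} \<Longrightarrow> x i \<in> {1..n}\<close>[OF j] by auto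
      then show "z \<in> ({1..k} - {j}) \<rightarrow>\<^sub>E {0..<n}" unfolding z d_def by auto
    qed
    ultimately have "card (P j) \<le> card (({1..k} - {j}) \<rightarrow>\<^sub>E {0..<n})"
      by (intro card_inj_on_le) (auto intro!: finite_PiE)
    also have "\<dots> = n ^ (k - 1)" using j by (subst card_PiE) auto
    finally show "card (P j) \<le> n ^ (k - 1)" .
  qed
  finally show ?thesis by simp
qed

text \<open>The non-minimal points \<open>N\<close> are counted by \<open>p\<close>, which keeps
  \<open>k - 1\<close> coordinates; the minimal ones by \<open>r\<close>, which drops only the last
  coordinate and whose image is an antichain.\<close>

lemma card_label_class_le:
  assumes "k \<ge> 1" "A \<in> permutation_arrays n k" and S: "S \<subseteq> array_support n k A"
    and same: "\<And>x y. x \<in> S \<Longrightarrow> y \<in> S \<Longrightarrow> \<forall>j \<in> {1..k}. x j < y j \<Longrightarrow> x (k + 1) = y (k + 1)"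
  shows "card S \<le> (k + 1) * n ^ (k - 1)"
proof -
  define N where "N = {x \<in> S. \<exists>y \<in> S. \<forall>j \<in> {1..k}. y j < x j}"
  define r where "r x = restrict x {1..k}" for x :: "nat \<Rightarrow> nat"
  define p where "p x = restrict x ({1..k} - {1})" for x :: "nat \<Rightarrow> nat"
  have fin: "finite S" using S finite_array_support finite_subset by blast
  have bnd: "x i \<in> {1..n}" if "x \<in> S" "i \<in> {1..k}" for x i
    using that S positionsD[of x n k i] by (auto simp: array_support_def)
  have "inj_on p N"
  proof (rule inj_onI)
    \<comment> \<open>A point \<open>z\<close> strictly below \<open>x\<close> is also strictly
      below \<open>y\<close>, because only coordinate 1 can differ among the first \<open>k\<close>,
      and there \<open>y\<close> is the larger. Both then share the last coordinate of
      \<open>z\<close>, so they lie on one line in direction 1.\<close>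
    have *: "x = y" if x: "x \<in> N" and y: "y \<in> N" and eq: "p x = p y" and le: "x 1 \<le> y 1" for x y
    proof -
      have agree: "x i = y i" if "i \<in> {1..k} - {1}" for i
        using fun_cong[OF eq, of i] that by (auto simp: p_def)
      obtain z where z: "z \<in> S" "\<forall>j \<in> {1..k}. z j < x j" using x by (auto simp: N_def)
      have "\<forall>j \<in> {1..k}. z j < y j"
      proof
        fix j assume j: "j \<in> {1..k}"
        show "z j < y j" using z(2) j le agree[of j] by (cases "j = 1") force+
      qed
      then have last: "x (k + 1) = y (k + 1)"
        using same[OF z(1), of x] same[OF z(1), of y] z x y by (auto simp: N_def)
      have "y i = x i" if "i \<in> {1..k + 1} - {1}" for i
        using that agree[of i] last by (cases "i = k + 1") auto
      then show ?thesis
        using array_support_eqI[OF assms(2), of x y 1] x y S by (auto simp: N_def)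
    qed
    fix x y assume "x \<in> N" "y \<in> N" "p x = p y"
    then show "x = y" using *[of x y] *[of y x] by (metis linear)
  qed
  moreover have "p ` N \<subseteq> ({1..k} - {1}) \<rightarrow>\<^sub>E {1..n}"
    using bnd by (auto simp: p_def N_def split: if_splits)
  ultimately have "card N \<le> card (({1..k} - {1}) \<rightarrow>\<^sub>E {1..n})"
    by (intro card_inj_on_le) (auto intro!: finite_PiE)
  also have "\<dots> = n ^ (k - 1)" using assms(1) by (subst card_PiE) auto
  finally have N: "card N \<le> n ^ (k - 1)" .
  have "inj_on r (S - N)"
  proof (rule inj_onI)
    fix x y assume xy: "x \<in> S - N" "y \<in> S - N" and eq: "r x = r y"
    have "y i = x i" if "i \<in> {1..k + 1} - {k + 1}" for i
      using fun_cong[OF eq, of i] that by (auto simp: r_def)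
    then show "x = y" using array_support_eqI[OF assms(2), of x y "k + 1"] xy S by auto
  qed
  then have "card (S - N) = card (r ` (S - N))" by (simp add: card_image)
  also have "\<dots> \<le> k * n ^ (k - 1)"
  proof (rule card_strict_antichain_le[OF assms(1)])
    show "r ` (S - N) \<subseteq> {1..k} \<rightarrow>\<^sub>E {1..n}" using bnd by (auto simp: r_def)
  next
    fix x y assume "x \<in> r ` (S - N)" "y \<in> r ` (S - N)"
    then show "\<not> (\<forall>j \<in> {1..k}. x j < y j)" by (fastforce simp: r_def N_def)
  qed
  finally have "card (S - N) \<le> k * n ^ (k - 1)" .
  moreover have "card S = card N + card (S - N)"
    using card_Un_disjoint[of N "S - N"] fin by (simp add: N_def Un_absorb1)
  ultimately show ?thesis using N by simp
qed

text \<open>A longest monotone subsequence bounds both chain heights, which leaves at most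
  \<open>?l\<^sup>2\<close> label classes; comparing the support with their total size and
  cancelling \<open>n ^ (k - 1)\<close> gives the estimate.\<close>

lemma long_monotone_subsequence:
  assumes "k \<ge> 1" "A \<in> permutation_arrays n k"
  obtains \<alpha>s where "monotone_subsequence n k A \<alpha>s" "n \<le> (k + 1) * (length \<alpha>s)\<^sup>2"
proof -
  let ?G = "array_support n k A"
  \<comment> \<open>Strict monotonicity in coordinate 1 makes the list distinct; this crude bound
    ensures that a longest monotone subsequence exists.\<close>
  have short: "length xs \<le> card ?G" if "monotone_subsequence n k A xs" for xs
  proof -
    have "1 \<in> {1..k + 1}" by simp
    then have "sorted_wrt (<) (map (\<lambda>\<alpha>. \<alpha> 1) xs) \<or> sorted_wrt (>) (map (\<lambda>\<alpha>. \<alpha> 1) xs)"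
      using that unfolding monotone_subsequence_def by blast
    then have "distinct (map (\<lambda>\<alpha>. \<alpha> 1) xs)"
    proof
      assume "sorted_wrt (>) (map (\<lambda>\<alpha>. \<alpha> 1) xs)"
      then have "sorted_wrt (<) (rev (map (\<lambda>\<alpha>. \<alpha> 1) xs))" by (simp only: sorted_wrt_rev)
      then show ?thesis by (metis strict_sorted_iff distinct_rev)
    qed (simp add: strict_sorted_iff)
    then have "length xs = card (set xs)" by (simp add: distinct_map distinct_card)
    also have "\<dots> \<le> card ?G"
      using that finite_array_support by (auto simp: monotone_subsequence_def intro: card_mono)
    finally show ?thesis .
  qed
  have "monotone_subsequence n k A []" by (simp add: monotone_subsequence_def)
  then obtain \<alpha>s where \<alpha>s: "monotone_subsequence n k A \<alpha>s"
    and max: "\<And>xs. monotone_subsequence n k A xs \<Longrightarrow> length xs \<le> length \<alpha>s"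
    using ex_has_greatest_nat[of "monotone_subsequence n k A" "[]" length "Suc (card ?G)"] short
    by (auto simp: less_Suc_eq_le)
  let ?l = "length \<alpha>s"
  define lt where "lt x y \<longleftrightarrow> (\<forall>j \<in> {1..k}. x j < y j)" for x y :: "nat \<Rightarrow> nat"
  define U where "U x y \<longleftrightarrow> lt x y \<and> x (k + 1) < y (k + 1)" for x y
  define D where "D x y \<longleftrightarrow> lt x y \<and> x (k + 1) > y (k + 1)" for x y
  have tr: "transp U" "transp D"
    by (rule transpI, auto simp: U_def D_def lt_def intro: less_trans)+
  have U: "length xs \<le> ?l" if "set xs \<subseteq> ?G" "sorted_wrt U xs" for xs
  proof (rule max)
    have "sorted_wrt (<) (map (\<lambda>\<alpha>. \<alpha> j) xs)" if "j \<in> {1..k + 1}" for j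
      unfolding sorted_wrt_map using \<open>sorted_wrt U xs\<close>
      by (rule sorted_wrt_mono_rel[rotated]) (use that in \<open>auto simp: U_def lt_def le_Suc_eq\<close>)
    then show "monotone_subsequence n k A xs"
      using that by (auto simp: monotone_subsequence_def)
  qed
  have D: "length xs \<le> ?l" if "set xs \<subseteq> ?G" "sorted_wrt D xs" for xs
  proof (rule max)
    have "sorted_wrt (<) (map (\<lambda>\<alpha>. \<alpha> j) xs)" if "j \<in> {1..k}" for j
      unfolding sorted_wrt_map using \<open>sorted_wrt D xs\<close>
      by (rule sorted_wrt_mono_rel[rotated]) (use that in \<open>auto simp: D_def lt_def\<close>)
    moreover have "sorted_wrt (>) (map (\<lambda>\<alpha>. \<alpha> (k + 1)) xs)"
      unfolding sorted_wrt_map using \<open>sorted_wrt D xs\<close>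
      by (rule sorted_wrt_mono_rel[rotated]) (auto simp: D_def)
    ultimately show "monotone_subsequence n k A xs"
      using that(1) unfolding monotone_subsequence_def
      by (metis Suc_eq_plus1 atLeastAtMost_iff le_Suc_eq)
  qed
  obtain f where f: "\<And>x. x \<in> ?G \<Longrightarrow> f x < ?l"
      "\<And>x y. x \<in> ?G \<Longrightarrow> y \<in> ?G \<Longrightarrow> U x y \<Longrightarrow> f x < f y"
    using chain_height[OF tr(1), of ?G ?l] U by metis
  obtain g where g: "\<And>x. x \<in> ?G \<Longrightarrow> g x < ?l"
      "\<And>x y. x \<in> ?G \<Longrightarrow> y \<in> ?G \<Longrightarrow> D x y \<Longrightarrow> g x < g y"
    using chain_height[OF tr(2), of ?G ?l] D by metis
  define S where "S = (\<lambda>(a, b). {x \<in> ?G. f x = a \<and> g x = b})"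
  let ?L = "{..<?l} \<times> {..<?l}"
  have "n ^ k \<le> card ?G" by (rule card_array_support_ge[OF assms(2)])
  also have "?G = (\<Union>ab \<in> ?L. S ab)" using f(1) g(1) by (auto simp: S_def)
  also have "card \<dots> \<le> (\<Sum>ab \<in> ?L. card (S ab))" by (rule card_UN_le) simp
  also have "\<dots> \<le> (\<Sum>ab \<in> ?L. (k + 1) * n ^ (k - 1))"
  proof (rule sum_mono, rule card_label_class_le[OF assms])
    fix ab x y
    show "S ab \<subseteq> ?G" by (auto simp: S_def)
    assume xy: "x \<in> S ab" "y \<in> S ab" and lt: "\<forall>j \<in> {1..k}. x j < y j"
    then have "x \<in> ?G" "y \<in> ?G" "f x = f y" "g x = g y" by (auto simp: S_def)
    \<comment> \<open>Either relation would make the labels differ, so the last coordinate can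
      neither grow nor drop.\<close>
    then have "\<not> U x y" "\<not> D x y" using f(2)[of x y] g(2)[of x y] by auto
    then show "x (k + 1) = y (k + 1)" using lt unfolding U_def D_def lt_def by linarith
  qed
  also have "\<dots> = ((k + 1) * ?l\<^sup>2) * n ^ (k - 1)"
    by (simp add: power2_eq_square algebra_simps)
  finally have *: "n ^ k \<le> ((k + 1) * ?l\<^sup>2) * n ^ (k - 1)" .
  have "n \<le> (k + 1) * ?l\<^sup>2"
  proof (cases "n = 0")
    case False
    have "n ^ k = n * n ^ (k - 1)" using assms(1) by (cases k) simp_all
    then show ?thesis using * False by simp
  qed simp
  then show ?thesis using that \<alpha>s by blast
qed

section \<open>Upper bound: arrays from sums modulo \<open>n\<close> and a scattering
  permutation\<close>

lemma dvd_add_ex1: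
  fixes n R :: nat
  assumes "n > 0"
  shows "\<exists>!z. z < n \<and> n dvd z + R"
proof (rule ex_ex1I)
  have "R mod n < n" using assms by simp
  then have "(n - R mod n) + R = n * (R div n + 1)"
    using mult_div_mod_eq[of n R] by (simp only: distrib_left mult_1_right)
  then have "((n - R mod n) + R) mod n = 0" by simp
  \<comment> \<open>The outer reduction matters when \<open>n\<close> divides \<open>R\<close>: then
    \<open>n - R mod n\<close> is \<open>n\<close> itself and the solution is 0.\<close>
  then have "n dvd (n - R mod n) mod n + R"
    by (simp add: mod_eq_0_iff_dvd[symmetric] mod_add_left_eq)
  then show "\<exists>z. z < n \<and> n dvd z + R" using assms mod_less_divisor by blast
next
  have "\<not> z < z'" if "z' < n" "n dvd z + R" "n dvd z' + R" for z z'
  proof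
    assume "z < z'"
    then have "n dvd z' - z" using dvd_diff_nat[OF that(3,2)] by simp
    then show False using \<open>z < z'\<close> that(1) by (auto dest: dvd_imp_le)
  qed
  then show "z = z'" if "z < n \<and> n dvd z + R" "z' < n \<and> n dvd z' + R" for z z'
    using that by (metis linorder_neqE_nat)
qed

text \<open>For bijections \<open>g i\<close> onto the residues this is the Latin hypercube of
  addition modulo \<open>n\<close>, with each coordinate relabelled.\<close>

definition sum_array :: "nat \<Rightarrow> nat \<Rightarrow> (nat \<Rightarrow> nat \<Rightarrow> nat) \<Rightarrow> (nat \<Rightarrow> nat) \<Rightarrow> nat" where
  "sum_array n k g =
     restrict (\<lambda>\<alpha>. if n dvd (\<Sum>i \<in> {1..k + 1}. g i (\<alpha> i)) then 1 else 0) (positions n k)"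

text \<open>On a line the fixed coordinates contribute a constant \<open>R\<close>. A single residue
  completes it to a multiple of \<open>n\<close>, and the bijection \<open>g j\<close> turns this
  residue into a single value of coordinate \<open>j\<close>.\<close>

lemma sum_array_in_permutation_arrays:
  assumes "k \<ge> 1" and g: "\<And>i. i \<in> {1..k + 1} \<Longrightarrow> bij_betw (g i) {1..n} {0..<n}"
  shows "sum_array n k g \<in> permutation_arrays n k"
  unfolding permutation_arrays_def
proof (intro CollectI conjI ballI)
  show "sum_array n k g \<in> positions n k \<rightarrow>\<^sub>E {0, 1}"
    unfolding sum_array_def by auto
  fix l assume "l \<in> lines n k"
  then obtain j v where l: "l = {\<alpha> \<in> positions n k. \<forall>i \<in> {1..k + 1} - {j}. \<alpha> i = v i}"
    and j: "j \<in> {1..k + 1}" and v: "v \<in> ({1..k + 1} - {j}) \<rightarrow>\<^sub>E {1..n}"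
    unfolding lines_def by blast
  define R where "R = (\<Sum>i \<in> {1..k + 1} - {j}. g i (v i))"
  \<comment> \<open>As \<open>k \<ge> 1\<close>, there is a coordinate other than \<open>j\<close>;
    its fixed value shows that \<open>n\<close> is positive.\<close>
  have "(if j = 1 then 2 else 1) \<in> {1..k + 1} - {j}" using assms(1) by auto
  from PiE_mem[OF v this] have "n > 0" by auto
  have sum: "(\<Sum>i \<in> {1..k + 1}. g i (\<alpha> i)) = g j (\<alpha> j) + R" if "\<alpha> \<in> l" for \<alpha>
  proof -
    have "(\<Sum>i \<in> {1..k + 1} - {j}. g i (\<alpha> i)) = R"
      unfolding R_def using that by (intro sum.cong) (auto simp: l)
    then show ?thesis using sum.remove[OF _ j, of "\<lambda>i. g i (\<alpha> i)"] by simp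
  qed
  have one: "sum_array n k g \<alpha> = 1 \<longleftrightarrow> n dvd g j (\<alpha> j) + R" if "\<alpha> \<in> l" for \<alpha>
    using that sum[OF that] by (simp add: sum_array_def l)
  obtain z where z: "z < n" "n dvd z + R" and uniq: "\<And>y. y < n \<Longrightarrow> n dvd y + R \<Longrightarrow> y = z"
    using dvd_add_ex1[OF \<open>n > 0\<close>] by blast
  obtain w where w: "w \<in> {1..n}" "g j w = z"
    using bij_betw_imp_surj_on[OF g[OF j]] z(1) by (metis atLeast0LessThan imageE lessThan_iff)
  show "\<exists>!\<alpha>. \<alpha> \<in> l \<and> sum_array n k g \<alpha> = 1"
  proof (rule ex1I)
    have "v(j := w) \<in> positions n k"
    proof (rule positionsI)
      show "1 \<le> (v(j := w)) i \<and> (v(j := w)) i \<le> n" if "i \<in> {1..k + 1}" for i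
        using that PiE_mem[OF v, of i] w by auto
      show "(v(j := w)) i = undefined" if "i \<notin> {1..k + 1}" for i
        using that PiE_arb[OF v, of i] j by auto
    qed
    then have "v(j := w) \<in> l" by (simp add: l)
    then show "v(j := w) \<in> l \<and> sum_array n k g (v(j := w)) = 1"
      using one[of "v(j := w)"] w z by simp
  next
    fix \<alpha> assume \<alpha>: "\<alpha> \<in> l \<and> sum_array n k g \<alpha> = 1"
    then have pos: "\<alpha> \<in> positions n k" by (simp add: l)
    have aj: "\<alpha> j \<in> {1..n}" using positionsD[OF pos j] by simp
    then have "g j (\<alpha> j) < n" using bij_betwE[OF g[OF j]] by auto
    then have "g j (\<alpha> j) = g j w" using uniq one \<alpha> w(2) by blast
    then have "\<alpha> j = w" using bij_betw_imp_inj_on[OF g[OF j]] aj w(1) by (auto dest: inj_onD)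
    show "\<alpha> = v(j := w)"
    proof
      fix i show "\<alpha> i = (v(j := w)) i"
        using \<open>\<alpha> j = w\<close> \<alpha> PiE_arb[OF v, of i] PiE_arb[OF pos[unfolded positions_def], of i]
        by (cases "i \<in> {1..k + 1}") (auto simp: l)
    qed
  qed
qed

text \<open>The permutation ranks the numbers by their two base \<open>m\<close> digits in swapped order, so that it
  separates the elements of every block.\<close>

lemma block_separating_permutation:
  fixes m n :: nat
  assumes "m\<^sup>2 \<le> n"
  obtains \<sigma> where "bij_betw \<sigma> {0..<n} {0..<n}"
    and "\<And>x y. x < y \<Longrightarrow> y < n \<Longrightarrow> x div m = y div m \<Longrightarrow> \<sigma> x + m \<le> \<sigma> y"
proof (cases "m = 0")
  case True
  show ?thesis by (rule that[of id]) (simp_all add: True)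
next
  case False
  then have m: "m > 0" by simp
  \<comment> \<open>Since \<open>x div m < n\<close>, comparing keys is comparing the pairs
    \<open>(x mod m, x div m)\<close> lexicographically, and \<open>\<sigma>\<close> is the rank in
    this order.\<close>
  define key where "key x = (x mod m) * n + x div m" for x
  define \<sigma> where "\<sigma> x = card {y. y < n \<and> key y < key x}" for x
  have div_less: "x div m < n" if "x < n" for x
    using that by (meson div_le_dividend le_less_trans)
  have mono: "\<sigma> x < \<sigma> y" if "x < n" "key x < key y" for x y
    unfolding \<sigma>_def by (rule psubset_card_mono) (use that in auto)
  have "inj_on \<sigma> {0..<n}"
  proof (rule inj_onI)
    fix x y assume xy: "x \<in> {0..<n}" "y \<in> {0..<n}" "\<sigma> x = \<sigma> y"
    then have "key x = key y" using mono[of x y] mono[of y x] by (metis atLeastLessThan_iff nat_neq_iff)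
    then have "key x div n = key y div n" "key x mod n = key y mod n" by simp_all
    then have "x mod m = y mod m" "x div m = y div m"
      using div_less xy by (auto simp: key_def)
    then show "x = y" by (metis div_mult_mod_eq)
  qed
  moreover have "\<sigma> ` {0..<n} \<subseteq> {0..<n}"
  proof
    fix s assume "s \<in> \<sigma> ` {0..<n}"
    then obtain x where x: "x < n" "s = \<sigma> x" by auto
    have "card {y. y < n \<and> key y < key x} < card {..<n}"
      by (rule psubset_card_mono) (use x in auto)
    then show "s \<in> {0..<n}" using x by (simp add: \<sigma>_def)
  qed
  ultimately have bij: "bij_betw \<sigma> {0..<n} {0..<n}"
    by (simp add: bij_betw_def endo_inj_surj)
  moreover have "\<sigma> x + m \<le> \<sigma> y" if xy: "x < y" "y < n" "x div m = y div m" for x y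
  proof -
    define a where "a = x div m"
    define b where "b = x mod m"
    have b: "b < y mod m"
      using xy(1,3) unfolding b_def
      by (metis add_less_cancel_left div_mult_mod_eq)
    have "y mod m < m" using m by simp
    have a: "a < n" using div_less xy by (simp add: a_def)
    have kx: "key x = b * n + a" and ky: "key y = (y mod m) * n + a"
      using xy(3) by (simp_all add: key_def a_def b_def)
    have next_row: "(b + 1) * n \<le> (y mod m) * n" using b by (intro mult_right_mono) auto
    \<comment> \<open>These are \<open>m\<close> elements, one in each of the first \<open>m\<close>
      blocks, with keys from \<open>key x\<close> inclusive to \<open>key y\<close> exclusive:
      blocks from \<open>a\<close> on use remainder \<open>b\<close>, earlier ones the next
      remainder. They lie below \<open>n\<close> because \<open>m\<^sup>2 \<le> n\<close>, and they
      count towards \<open>\<sigma> y\<close> but not towards \<open>\<sigma> x\<close>.\<close>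
    define w where "w c = c * m + (if c \<ge> a then b else b + 1)" for c
    have w_dig: "w c div m = c" "w c mod m = (if c \<ge> a then b else b + 1)" for c
      using b \<open>y mod m < m\<close> by (simp_all add: w_def)
    have w_less: "w c < n" if "c < m" for c
    proof -
      have "w c < (c + 1) * m" using b \<open>y mod m < m\<close> by (auto simp: w_def)
      also have "\<dots> \<le> m * m" using that by (intro mult_right_mono) auto
      finally show ?thesis using assms by (simp add: power2_eq_square)
    qed
    have w_key: "key x \<le> key (w c) \<and> key (w c) < key y" if "c < m" for c
    proof -
      have "c < n" using div_less[OF w_less[OF that]] w_dig by simp
      then show ?thesis using next_row a unfolding kx ky by (auto simp: key_def w_dig)
    qed
    have "inj_on w {..<m}" by (rule inj_onI) (metis w_dig(1))
    then have "card (w ` {..<m}) = m" by (simp add: card_image)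
    moreover have "{z. z < n \<and> key z < key x} \<inter> w ` {..<m} = {}"
      using w_key by force
    ultimately have "\<sigma> x + m = card ({z. z < n \<and> key z < key x} \<union> w ` {..<m})"
      by (subst card_Un_disjoint) (auto simp: \<sigma>_def)
    also have "\<dots> \<le> \<sigma> y"
      unfolding \<sigma>_def
    proof (rule card_mono)
      show "{z. z < n \<and> key z < key x} \<union> w ` {..<m} \<subseteq> {z. z < n \<and> key z < key y}"
        using w_key w_less m by (force intro: le_less_trans)
    qed simp
    finally show ?thesis .
  qed
  ultimately show ?thesis using that by blast
qed

text \<open>Along a monotone sequence the vector of block indices changes few times, and is recovered
  from the potential \<open>\<Phi>\<close>. As long as it is constant, the coordinates other than the first have an
  almost constant sum, so the image under \<open>\<sigma>\<close> of the first coordinate is confined to a few short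
  intervals, labelled by \<open>T \<alpha> div n\<close> and \<open>\<rho> \<alpha> div m\<close>, each of which contains at most one value.\<close>

lemma sum_array_monotone_length_le:
  fixes k m n :: nat and \<sigma> :: "nat \<Rightarrow> nat"
  defines "g \<equiv> \<lambda>i x. if i = 1 then \<sigma> (x - 1) else x - 1"
  assumes m: "m > 0"
    and bij: "bij_betw \<sigma> {0..<n} {0..<n}"
    and sep: "\<And>x y. x < y \<Longrightarrow> y < n \<Longrightarrow> x div m = y div m \<Longrightarrow> \<sigma> x + m \<le> \<sigma> y"
    and chain: "monotone_subsequence n k (sum_array n k g) \<alpha>s"
  shows "length \<alpha>s \<le> Suc ((k + 1) * (n div m)) * ((k + 1) * (k + 1))"
proof -
  define D where "D = n div m"
  define I where "I = {j. sorted_wrt (<) (map (\<lambda>\<alpha>. \<alpha> j) \<alpha>s)}"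
  define a where "a i \<alpha> = (\<alpha> i - 1) div m" for i :: nat and \<alpha> :: "nat \<Rightarrow> nat"
  \<comment> \<open>Block indices of decreasing coordinates are reflected, so that every
    \<open>h i\<close>, and hence \<open>\<Phi>\<close>, is nondecreasing along the
    sequence.\<close>
  define h where "h i \<alpha> = (if i \<in> I then a i \<alpha> else D - a i \<alpha>)" for i \<alpha>
  define \<Phi> where "\<Phi> \<alpha> = (\<Sum>i \<in> {1..k + 1}. h i \<alpha>)" for \<alpha>
  define T where "T \<alpha> = (\<Sum>i \<in> {1..k + 1}. g i (\<alpha> i))" for \<alpha>
  define \<rho> where "\<rho> \<alpha> = (\<Sum>i \<in> {2..k + 1}. (\<alpha> i - 1) mod m)" for \<alpha> :: "nat \<Rightarrow> nat"
  define label where "label \<alpha> = (\<Phi> \<alpha>, T \<alpha> div n, \<rho> \<alpha> div m)" for \<alpha>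
  have supp: "\<alpha> \<in> positions n k" "n dvd T \<alpha>" if "\<alpha> \<in> set \<alpha>s" for \<alpha>
    using chain that
    by (auto simp: monotone_subsequence_def array_support_def sum_array_def T_def split: if_splits)
  have bnd: "1 \<le> \<alpha> i" "\<alpha> i \<le> n" "\<alpha> i - 1 < n" if "\<alpha> \<in> set \<alpha>s" "i \<in> {1..k + 1}" for \<alpha> i
    using positionsD[OF supp(1)[OF that(1)] that(2)] by auto
  have aD: "a i \<alpha> \<le> D" if "\<alpha> \<in> set \<alpha>s" "i \<in> {1..k + 1}" for \<alpha> i
    using bnd[OF that] unfolding a_def D_def by (intro div_le_mono) simp
  \<comment> \<open>Splitting into block index and remainder isolates what can still vary within
    fixed blocks: the value of \<open>\<sigma>\<close> and \<open>\<rho>\<close>.\<close>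
  have T_split: "T \<alpha> = \<sigma> (\<alpha> 1 - 1) + m * (\<Sum>i \<in> {2..k + 1}. a i \<alpha>) + \<rho> \<alpha>" for \<alpha>
  proof -
    have "{1..k + 1} = insert 1 {2..k + 1}" by auto
    then have "T \<alpha> = g 1 (\<alpha> 1) + (\<Sum>i \<in> {2..k + 1}. g i (\<alpha> i))" by (simp add: T_def)
    also have "(\<Sum>i \<in> {2..k + 1}. g i (\<alpha> i)) = (\<Sum>i \<in> {2..k + 1}. m * a i \<alpha> + (\<alpha> i - 1) mod m)"
      by (intro sum.cong) (auto simp: g_def a_def)
    finally show ?thesis by (simp only: g_def \<rho>_def sum.distrib sum_distrib_left if_True simp_thms add.assoc)
  qed
  have no_repeat: "label (\<alpha>s ! s) \<noteq> label (\<alpha>s ! t)" if "s < t" "t < length \<alpha>s" for s t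
  proof
    define \<alpha> where "\<alpha> = \<alpha>s ! s"
    define \<beta> where "\<beta> = \<alpha>s ! t"
    assume "label (\<alpha>s ! s) = label (\<alpha>s ! t)"
    then have eq: "\<Phi> \<alpha> = \<Phi> \<beta>" "T \<alpha> div n = T \<beta> div n" "\<rho> \<alpha> div m = \<rho> \<beta> div m"
      by (simp_all add: label_def \<alpha>_def \<beta>_def)
    have mem: "\<alpha> \<in> set \<alpha>s" "\<beta> \<in> set \<alpha>s" using that by (simp_all add: \<alpha>_def \<beta>_def)
    have dir: "i \<in> I \<and> \<alpha> i < \<beta> i \<or> i \<notin> I \<and> \<beta> i < \<alpha> i" if i: "i \<in> {1..k + 1}" for i
    proof (cases "i \<in> I")
      case True
      then have "map (\<lambda>\<alpha>. \<alpha> i) \<alpha>s ! s < map (\<lambda>\<alpha>. \<alpha> i) \<alpha>s ! t"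
        unfolding I_def using \<open>s < t\<close> \<open>t < length \<alpha>s\<close> by (intro sorted_wrt_nth_less[of "(<)"]) auto
      then show ?thesis using True \<open>s < t\<close> \<open>t < length \<alpha>s\<close> by (simp add: \<alpha>_def \<beta>_def)
    next
      case False
      then have "sorted_wrt (>) (map (\<lambda>\<alpha>. \<alpha> i) \<alpha>s)"
        using chain i by (auto simp: I_def monotone_subsequence_def)
      then have "map (\<lambda>\<alpha>. \<alpha> i) \<alpha>s ! s > map (\<lambda>\<alpha>. \<alpha> i) \<alpha>s ! t"
        using \<open>s < t\<close> \<open>t < length \<alpha>s\<close> by (intro sorted_wrt_nth_less[of "(>)"]) auto
      then show ?thesis using False \<open>s < t\<close> \<open>t < length \<alpha>s\<close> by (simp add: \<alpha>_def \<beta>_def)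
    qed
    have "h i \<alpha> \<le> h i \<beta>" if "i \<in> {1..k + 1}" for i
    proof (cases "i \<in> I")
      case True
      then show ?thesis using dir[OF that] by (auto simp: h_def a_def intro!: div_le_mono)
    next
      case False
      then have "a i \<beta> \<le> a i \<alpha>" using dir[OF that] by (auto simp: a_def intro!: div_le_mono)
      then show ?thesis using False by (simp add: h_def)
    qed
    \<comment> \<open>Termwise inequality with equal sums forces equality in every term.\<close>
    then have "h i \<alpha> = h i \<beta>" if "i \<in> {1..k + 1}" for i
      using sum_mono_inv[of "\<lambda>i. h i \<alpha>" "{1..k + 1}" "\<lambda>i. h i \<beta>" i] eq(1) that by (auto simp: \<Phi>_def)
    then have a_eq: "a i \<alpha> = a i \<beta>" if "i \<in> {1..k + 1}" for i
      using that aD[OF mem(1) that] aD[OF mem(2) that] by (force simp: h_def split: if_splits)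
    have "T \<alpha> = T \<beta>" using eq(2) supp(2)[OF mem(1)] supp(2)[OF mem(2)] by (metis dvd_div_mult_self)
    moreover have "(\<Sum>i \<in> {2..k + 1}. a i \<alpha>) = (\<Sum>i \<in> {2..k + 1}. a i \<beta>)"
      using a_eq by (intro sum.cong) auto
    ultimately have sums: "\<sigma> (\<alpha> 1 - 1) + \<rho> \<alpha> = \<sigma> (\<beta> 1 - 1) + \<rho> \<beta>"
      by (simp add: T_split)
    \<comment> \<open>Equal quotients keep the values of \<open>\<rho>\<close>, and by
      \<open>sums\<close> also those of \<open>\<sigma>\<close>, less than \<open>m\<close> apart.
      By \<open>sep\<close> the first coordinates, being in one block, must coincide, although they
      are strictly monotone along the sequence.\<close>
    have "\<rho> \<alpha> mod m < m" "\<rho> \<beta> mod m < m" using m by simp_all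
    then have "\<rho> \<alpha> < \<rho> \<beta> + m" "\<rho> \<beta> < \<rho> \<alpha> + m"
      using div_mult_mod_eq[of "\<rho> \<alpha>" m, unfolded eq(3)] div_mult_mod_eq[of "\<rho> \<beta>" m]
      by linarith+
    then have "\<not> \<sigma> (\<alpha> 1 - 1) + m \<le> \<sigma> (\<beta> 1 - 1)" "\<not> \<sigma> (\<beta> 1 - 1) + m \<le> \<sigma> (\<alpha> 1 - 1)"
      using sums by linarith+
    moreover have "(\<alpha> 1 - 1) div m = (\<beta> 1 - 1) div m" using a_eq[of 1] by (simp add: a_def)
    ultimately have "\<not> \<alpha> 1 - 1 < \<beta> 1 - 1" "\<not> \<beta> 1 - 1 < \<alpha> 1 - 1"
      using sep[of "\<alpha> 1 - 1" "\<beta> 1 - 1"] sep[of "\<beta> 1 - 1" "\<alpha> 1 - 1"]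
        bnd(3)[OF mem(1), of 1] bnd(3)[OF mem(2), of 1] by auto
    then have "\<alpha> 1 = \<beta> 1"
      using bnd(1)[OF mem(1), of 1] bnd(1)[OF mem(2), of 1] by auto
    then show False using dir[of 1] by auto
  qed
  have "inj_on (\<lambda>s. label (\<alpha>s ! s)) {..<length \<alpha>s}"
    using no_repeat by (intro linorder_inj_onI) auto
  moreover have "(\<lambda>s. label (\<alpha>s ! s)) ` {..<length \<alpha>s} \<subseteq> {..(k + 1) * D} \<times> {..k} \<times> {..k}"
  proof
    fix p assume "p \<in> (\<lambda>s. label (\<alpha>s ! s)) ` {..<length \<alpha>s}"
    then obtain \<alpha> where \<alpha>: "\<alpha> \<in> set \<alpha>s" and p: "p = label \<alpha>" using nth_mem by blast
    have "h i \<alpha> \<le> D" if "i \<in> {1..k + 1}" for i using aD[OF \<alpha> that] by (simp add: h_def)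
    then have "\<Phi> \<alpha> \<le> (k + 1) * D"
      unfolding \<Phi>_def using sum_bounded_above[of "{1..k + 1}" "\<lambda>i. h i \<alpha>" D] by simp
    moreover have "T \<alpha> div n \<le> k"
    proof -
      have "g i (\<alpha> i) < n" if "i \<in> {1..k + 1}" for i
        using bnd(3)[OF \<alpha> that] bij_betwE[OF bij] by (auto simp: g_def)
      then have "T \<alpha> < (k + 1) * n"
        unfolding T_def using sum_bounded_above_strict[of "{1..k + 1}" "\<lambda>i. g i (\<alpha> i)" n] by simp
      then show ?thesis by (simp add: less_mult_imp_div_less less_Suc_eq_le[symmetric])
    qed
    moreover have "\<rho> \<alpha> div m \<le> k"
    proof -
      have "\<rho> \<alpha> \<le> k * m"
        unfolding \<rho>_def using sum_bounded_above[of "{2..k + 1}" "\<lambda>i. (\<alpha> i - 1) mod m" m] m by simp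
      then have "\<rho> \<alpha> div m \<le> k * m div m" by (rule div_le_mono)
      then show ?thesis using m by simp
    qed
    ultimately show "p \<in> {..(k + 1) * D} \<times> {..k} \<times> {..k}" by (simp add: p label_def)
  qed
  ultimately have "card {..<length \<alpha>s} \<le> card ({..(k + 1) * D} \<times> {..k} \<times> {..k})"
    by (rule card_inj_on_le) simp
  then show ?thesis by (simp add: D_def card_cartesian_product)
qed

text \<open>The choice \<open>m = floor_sqrt n\<close> meets the requirement
  \<open>m\<^sup>2 \<le> n\<close> of the permutation and still keeps the number of blocks of order
  \<open>m\<close>.\<close>

lemma short_monotone_subsequences:
  assumes "k \<ge> 1"
  obtains A where "A \<in> permutation_arrays n k"
    and "\<And>\<alpha>s. monotone_subsequence n k A \<alpha>s \<Longrightarrow> length \<alpha>s \<le> 4 * (k + 1) ^ 3 * floor_sqrt n"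
proof -
  define m where "m = floor_sqrt n"
  obtain \<sigma> where bij: "bij_betw \<sigma> {0..<n} {0..<n}"
    and sep: "\<And>x y. x < y \<Longrightarrow> y < n \<Longrightarrow> x div m = y div m \<Longrightarrow> \<sigma> x + m \<le> \<sigma> y"
    using block_separating_permutation[of m n] floor_sqrt_power2_le[of n] by (metis m_def)
  define g where "g = (\<lambda>i x. if i = (1::nat) then \<sigma> (x - 1) else x - 1)"
  have pred: "bij_betw (\<lambda>x. x - 1) {1..n} {0..<n}"
    by (rule bij_betw_byWitness[where f' = "\<lambda>x. x + 1"]) auto
  have "bij_betw (g i) {1..n} {0..<n}" for i
    using pred bij_betw_trans[OF pred bij] unfolding g_def comp_def by (cases "i = 1") simp_all
  then have mem: "sum_array n k g \<in> permutation_arrays n k"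
    by (intro sum_array_in_permutation_arrays assms)
  moreover have "length \<alpha>s \<le> 4 * (k + 1) ^ 3 * m"
    if chain: "monotone_subsequence n k (sum_array n k g) \<alpha>s" for \<alpha>s
  \<comment> \<open>For \<open>n = 0\<close> the block length would be 0, but then only the empty
    sequence exists.\<close>
  proof (cases "n = 0")
    case True
    have "positions 0 k = {}" by (auto simp: positions_def PiE_eq_empty_iff)
    then have "\<alpha>s = []" using chain True by (simp add: monotone_subsequence_def array_support_def)
    then show ?thesis by simp
  next
    case False
    then have m: "m > 0" by (simp add: m_def)
    have "n < (m + 1)\<^sup>2" using Suc_floor_sqrt_power2_gt[of n] by (simp add: m_def)
    \<comment> \<open>For \<open>m \<ge> 1\<close>,
      \<open>m\<^sup>2 + 2 * m + 1 \<le> 3 * m\<^sup>2 + m\<close>. The factor 4 in the final bound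
      is this 3 plus 1 for absorbing the \<open>Suc\<close>.\<close>
    also have "\<dots> \<le> Suc (3 * m) * m" using m by (cases m) (simp_all add: power2_eq_square algebra_simps)
    finally have "n div m \<le> 3 * m" using less_mult_imp_div_less less_Suc_eq_le by blast
    have "length \<alpha>s \<le> Suc ((k + 1) * (n div m)) * ((k + 1) * (k + 1))"
      using sum_array_monotone_length_le[OF m bij sep, of k \<alpha>s] chain unfolding g_def by blast
    also have "\<dots> \<le> (4 * (k + 1) * m) * ((k + 1) * (k + 1))"
    proof (rule mult_right_mono)
      have "(k + 1) * (n div m) \<le> (k + 1) * (3 * m)"
        using \<open>n div m \<le> 3 * m\<close> by (rule mult_left_mono) simp
      moreover have "1 \<le> (k + 1) * m" using m by simp
      ultimately show "Suc ((k + 1) * (n div m)) \<le> 4 * (k + 1) * m" by (simp add: algebra_simps)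
    qed simp
    also have "\<dots> = 4 * (k + 1) ^ 3 * m" by (simp only: power3_eq_cube ac_simps)
    finally show ?thesis .
  qed
  ultimately show ?thesis using that m_def by blast
qed

section \<open>Both estimates in terms of the real square root\<close>

theorem theorem4:
  fixes k :: nat
  assumes "k \<ge> 1"
  shows "(\<exists>c::real. c > 0 \<and>
            (\<forall>n::nat. \<forall>A \<in> permutation_arrays n k.
               \<exists>\<alpha>s. monotone_subsequence n k A \<alpha>s \<and> real (length \<alpha>s) \<ge> c * sqrt (real n)))
       \<and> (\<exists>C::real.
            (\<forall>n::nat. \<exists>A \<in> permutation_arrays n k.
               \<forall>\<alpha>s. monotone_subsequence n k A \<alpha>s \<longrightarrow> real (length \<alpha>s) \<le> C * sqrt (real n)))"
proof (rule conjI; rule exI)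
  \<comment> \<open>The constant results from taking square roots in
    \<open>n \<le> (k + 1) * (length \<alpha>s)\<^sup>2\<close>.\<close>
  have "1 / sqrt (real (k + 1)) > 0" by simp
  moreover have "\<exists>\<alpha>s. monotone_subsequence n k A \<alpha>s \<and>
      real (length \<alpha>s) \<ge> 1 / sqrt (real (k + 1)) * sqrt (real n)"
    if "A \<in> permutation_arrays n k" for n A
  proof -
    obtain \<alpha>s where \<alpha>s: "monotone_subsequence n k A \<alpha>s" "n \<le> (k + 1) * (length \<alpha>s)\<^sup>2"
      using long_monotone_subsequence[OF assms \<open>A \<in> permutation_arrays n k\<close>] by blast
    have "sqrt (real n) \<le> sqrt (real ((k + 1) * (length \<alpha>s)\<^sup>2))"
      using \<alpha>s(2) by (intro real_sqrt_le_mono) (rule of_nat_mono)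
    also have "\<dots> = sqrt (real (k + 1)) * real (length \<alpha>s)"
      by (simp only: of_nat_mult real_sqrt_mult of_nat_power real_sqrt_abs abs_of_nat)
    finally show ?thesis
      using \<alpha>s(1) by (intro exI[of _ \<alpha>s]) (simp add: field_simps)
  qed
  ultimately show "1 / sqrt (real (k + 1)) > 0 \<and> (\<forall>n. \<forall>A \<in> permutation_arrays n k.
      \<exists>\<alpha>s. monotone_subsequence n k A \<alpha>s \<and>
        real (length \<alpha>s) \<ge> 1 / sqrt (real (k + 1)) * sqrt (real n))"
    by blast
next
  show "\<forall>n. \<exists>A \<in> permutation_arrays n k. \<forall>\<alpha>s. monotone_subsequence n k A \<alpha>s \<longrightarrow>
      real (length \<alpha>s) \<le> real (4 * (k + 1) ^ 3) * sqrt (real n)"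
  proof
    fix n
    obtain A where A: "A \<in> permutation_arrays n k"
      and short: "\<And>\<alpha>s. monotone_subsequence n k A \<alpha>s \<Longrightarrow> length \<alpha>s \<le> 4 * (k + 1) ^ 3 * floor_sqrt n"
      using short_monotone_subsequences[OF assms] by blast
    have "real (floor_sqrt n) \<le> sqrt (real n)"
      using floor_sqrt_power2_le[of n] by (intro real_le_rsqrt) (metis of_nat_le_iff of_nat_power)
    then have "real (4 * (k + 1) ^ 3) * real (floor_sqrt n) \<le> real (4 * (k + 1) ^ 3) * sqrt (real n)"
      by (rule mult_left_mono) simp
    moreover have "real (length \<alpha>s) \<le> real (4 * (k + 1) ^ 3) * real (floor_sqrt n)"
      if "monotone_subsequence n k A \<alpha>s" for \<alpha>s
      using of_nat_mono[OF short[OF that], where 'a = real] by (simp only: of_nat_mult)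
    ultimately show "\<exists>A \<in> permutation_arrays n k. \<forall>\<alpha>s. monotone_subsequence n k A \<alpha>s \<longrightarrow>
        real (length \<alpha>s) \<le> real (4 * (k + 1) ^ 3) * sqrt (real n)"
      using A by (meson order_trans)
  qed
qed

end
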